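(* Let $\mu>0$, $\theta>0$, $\alpha<-2$ be real numbers, let $d(p)=\mu\,\dfrac{e^{-(\alpha+\theta p)}}{1+e^{-(\alpha+\theta p)}}$ be the logit demand function, and let $R(p)=p\,d(p)$ be the corresponding revenue function, for prices $p\ge 0$. Then the price $$p^*=\frac{1}{\theta}\left[1+W\!\left(e^{-(\alpha+1)}\right)\right]$$ is the unique global maximizer of $R$ over $[0,\infty)$.
   Context: $W$ denotes the (principal real branch of the) Lambert $W$ function: for $x>0$, $W(x)$ is the unique real number $z>0$ with $z e^{z}=x$. The feasible price domain is $p\ge 0$. *)

theory Defs
  imports Complex_Main
begin

(* Only meaningful for x > 0, where the positive solution exists and is unique
   (see lambert_W_ex1); there it is the principal real branch. *)
definition lambert_W :: "real \<Rightarrow> real" where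
  "lambert_W x = (THE z. 0 < z \<and> z * exp z = x)"

lemma lambert_W_ex1:
  fixes x :: real
  assumes "0 < x"
  shows "\<exists>!z. 0 < z \<and> z * exp z = x"
proof -
  have "\<exists>z\<ge>0. z \<le> x \<and> z * exp z = x"
  proof (rule IVT')
    show "0 * exp 0 \<le> x" "0 \<le> x" using assms by simp_all
    show "x \<le> x * exp x" using assms by simp
    show "continuous_on {0..x} (\<lambda>z. z * exp z)" by (intro continuous_intros)
  qed
  then obtain z where z: "0 \<le> z" "z * exp z = x" by blast
  with assms have "0 < z" by (cases "z = 0") auto
  moreover have "y = z" if "0 < y" "y * exp y = x" for y
  proof (rule ccontr)
    have mono: "a * exp a < b * exp b" if "0 < a" "a < b" for a b :: real
      using that by (intro mult_strict_mono) auto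
    assume "y \<noteq> z"
    then show False
      using mono[of y z] mono[of z y] that z \<open>0 < z\<close> by linarith
  qed
  ultimately show ?thesis using z by blast
qed

definition logit_demand :: "real \<Rightarrow> real \<Rightarrow> real \<Rightarrow> real \<Rightarrow> real" where
  "logit_demand \<mu> \<theta> \<alpha> p =
     \<mu> * (exp (-(\<alpha> + \<theta> * p)) / (1 + exp (-(\<alpha> + \<theta> * p))))"

definition logit_revenue :: "real \<Rightarrow> real \<Rightarrow> real \<Rightarrow> real \<Rightarrow> real" where
  "logit_revenue \<mu> \<theta> \<alpha> p = p * logit_demand \<mu> \<theta> \<alpha> p"

end

(* With w = W(exp(-(\<alpha>+1))) and t = \<theta> p - 1 - w, the exponential exp(-(\<alpha> + \<theta> p)) equals w * exp(-t),
   so the inequality R(p) < \<mu> w / \<theta> = R((1 + w) / \<theta>) is just 1 + t < exp t, which holds for all t \<noteq> 0. *)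
theory Submission
  imports Defs
begin

lemma lambert_W_pos:
  fixes x :: real
  assumes "0 < x"
  shows "0 < lambert_W x"
  unfolding lambert_W_def using theI'[OF lambert_W_ex1[OF assms]] by blast

lemma lambert_W_times_exp:
  fixes x :: real
  assumes "0 < x"
  shows "lambert_W x * exp (lambert_W x) = x"
  unfolding lambert_W_def using theI'[OF lambert_W_ex1[OF assms]] by blast

text \<open>The weak inequality is standard. Strictness comes from the logarithm:
  \<open>ln x = x - 1\<close> forces \<open>x = 1\<close>, so equality at \<open>x = 1 + t\<close>
  would give \<open>t = 0\<close>. When \<open>1 + t\<close> is not positive, positivity of
  \<open>exp\<close> suffices.\<close>

lemma add_one_less_exp:
  fixes t :: real
  assumes "t \<noteq> 0"
  shows "1 + t < exp t"
proof (cases "1 + t > 0")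
  case True
  have "ln (1 + t) \<noteq> t"
    using ln_eq_minus_one[of "1 + t"] True assms by auto
  then have "1 + t \<noteq> exp t" by auto
  then show ?thesis using exp_ge_add_one_self[of t] by linarith
next
  case False
  then show ?thesis using exp_gt_zero[of t] by linarith
qed

text \<open>Splitting off the factor \<open>exp (-(\<alpha> + 1))\<close> allows it to be replaced
  by \<open>w * exp w\<close>, the defining equation of \<open>lambert_W\<close>; from then on
  \<alpha> enters only through \<open>w\<close>.\<close>

lemma exp_logit_exponent:
  fixes \<theta> \<alpha> p :: real
  defines "w \<equiv> lambert_W (exp (-(\<alpha> + 1)))"
  shows "exp (-(\<alpha> + \<theta> * p)) = w * exp (-(\<theta> * p - 1 - w))"
proof -
  have "exp (-(\<alpha> + \<theta> * p)) = exp (-(\<alpha> + 1)) * exp (1 - \<theta> * p)"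
    by (simp flip: exp_add)
  also have "\<dots> = w * exp w * exp (1 - \<theta> * p)"
    unfolding w_def by (subst lambert_W_times_exp) auto
  also have "\<dots> = w * exp (-(\<theta> * p - 1 - w))"
    by (simp add: mult.assoc flip: exp_add)
  finally show ?thesis .
qed

text \<open>At this price the shift \<open>\<theta> * p - 1 - w\<close> vanishes, so the exponential
  is \<open>w\<close> itself and the factor \<open>1 + w\<close> of the price cancels the
  denominator of the demand.\<close>

lemma logit_revenue_at_maximizer:
  fixes \<mu> \<theta> \<alpha> :: real
  assumes "\<theta> > 0"
  defines "w \<equiv> lambert_W (exp (-(\<alpha> + 1)))"
  shows "logit_revenue \<mu> \<theta> \<alpha> (1 / \<theta> * (1 + w)) = \<mu> * w / \<theta>"
proof -
  have "w > 0" unfolding w_def by (simp add: lambert_W_pos)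
  have E: "exp (-(\<alpha> + \<theta> * (1 / \<theta> * (1 + w)))) = w"
    using exp_logit_exponent[of \<alpha> \<theta> "1 / \<theta> * (1 + w)"] assms(1) unfolding w_def by simp
  have "1 + w \<noteq> 0" using \<open>w > 0\<close> by simp
  then show ?thesis
    unfolding logit_revenue_def logit_demand_def E by (simp add: mult_ac)
qed

lemma logit_revenue_less:
  fixes \<mu> \<theta> \<alpha> p :: real
  assumes "\<mu> > 0" and "\<theta> > 0"
  defines "w \<equiv> lambert_W (exp (-(\<alpha> + 1)))"
  assumes "p \<noteq> 1 / \<theta> * (1 + w)"
  shows "logit_revenue \<mu> \<theta> \<alpha> p < \<mu> * w / \<theta>"
proof -
  define t where "t = \<theta> * p - 1 - w"
  define E where "E = w * exp (-t)"
  have w: "w > 0" unfolding w_def by (simp add: lambert_W_pos)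
  then have E: "E > 0" unfolding E_def by simp
  \<comment> \<open>\<open>t = 0\<close> characterizes the excluded price, and \<theta>
    \<open>* p\<close> equals \<open>1 + t + w\<close>.\<close>
  have "t \<noteq> 0" using assms(2,4) unfolding t_def by (auto simp: field_simps)
  then have "\<theta> * p < exp t + w"
    using add_one_less_exp[of t] unfolding t_def by linarith
  then have "\<theta> * p * E < (exp t + w) * E" using E by simp
  \<comment> \<open>\<open>exp t * E = w\<close>, so \<open>w\<close> factors out and division by
    \<open>1 + E\<close> produces the logit fraction.\<close>
  also have "\<dots> = w * (1 + E)"
    unfolding E_def by (simp add: algebra_simps flip: exp_add)
  finally have "\<theta> * p * (E / (1 + E)) < w" using E by (simp add: field_simps)
  then have "\<mu> / \<theta> * (\<theta> * p * (E / (1 + E))) < \<mu> / \<theta> * w"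
    using assms(1,2) by (intro mult_strict_left_mono) auto
  moreover have "logit_revenue \<mu> \<theta> \<alpha> p = \<mu> / \<theta> * (\<theta> * p * (E / (1 + E)))"
    using assms(2) exp_logit_exponent[of \<alpha> \<theta> p]
    unfolding logit_revenue_def logit_demand_def E_def t_def w_def by simp
  ultimately show ?thesis by simp
qed

theorem mainTheorem2:
  fixes \<mu> \<theta> \<alpha> :: real
  assumes "\<mu> > 0" and "\<theta> > 0" and "\<alpha> < -2"
  shows "\<forall>p. is_arg_max (logit_revenue \<mu> \<theta> \<alpha>) (\<lambda>q. q \<in> {0..}) p \<longleftrightarrow>
             p = 1 / \<theta> * (1 + lambert_W (exp (-(\<alpha> + 1))))"
proof -
  define p\<^sub>0 where "p\<^sub>0 = 1 / \<theta> * (1 + lambert_W (exp (-(\<alpha> + 1))))"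
  have "p\<^sub>0 \<ge> 0"
    unfolding p\<^sub>0_def using assms(2) lambert_W_pos[of "exp (-(\<alpha> + 1))"] by simp
  moreover have "logit_revenue \<mu> \<theta> \<alpha> q < logit_revenue \<mu> \<theta> \<alpha> p\<^sub>0" if "q \<noteq> p\<^sub>0" for q
    using logit_revenue_less[OF assms(1,2)] logit_revenue_at_maximizer[OF assms(2)] that
    unfolding p\<^sub>0_def by simp
  \<comment> \<open>\<open>is_arg_max\<close> only forbids a strictly better feasible point.
    Uniqueness follows because the feasible \<open>p\<^sub>0\<close> strictly beats every other
    price.\<close>
  ultimately have "is_arg_max (logit_revenue \<mu> \<theta> \<alpha>) (\<lambda>q. q \<in> {0..}) p \<longleftrightarrow> p = p\<^sub>0" for p
    unfolding is_arg_max_def atLeast_iff by (metis less_asym less_irrefl)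
  then show ?thesis unfolding p\<^sub>0_def by blast
qed

end
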